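(* Let $\mathbb{F}$ be a normed field of characteristic zero and let $\mathfrak{A}$ be a complete metric $\mathbb{F}$-algebra. If $\mathfrak{A}$ (as a ring) has no nonzero nil two-sided ideals, then $\mathfrak{A}$ has no nonzero nil one-sided (left or right) ideals.
   Context: Algebras are associative and not necessarily unital. A (one-sided or two-sided) ideal $I$ is nil if for every $a\in I$ there is a positive integer $n$ (depending on $a$) with $a^n=0$. A normed field is a field $\mathbb{F}$ equipped with a map $|\cdot|:\mathbb{F}\to\mathbb{R}_{\geq 0}$ having the usual properties of a norm ($|\lambda|=0$ iff $\lambda=0$, and $|\lambda+\mu|\leq|\lambda|+|\mu|$) and satisfying $|-\lambda|=|\lambda|$ and $|\lambda\mu|\leq|\lambda|\cdot|\mu|$ for all $\lambda,\mu\in\mathbb{F}$. When $\mathrm{char}(\mathbb{F})=0$, it is moreover assumed, as part of the definition, that $|n\cdot\lambda|=n\cdot|\lambda|$ for all $n\in\mathbb{N}$ and $\lambda\in\mathbb{F}$. Let $\mathbb{F}$ be a normed field. A metric $\mathbb{F}$-algebra is an associative $\mathbb{F}$-algebra $\mathfrak{A}$ which is also a metric space $(\mathfrak{A},\mathsf{d})$, such that there is a real number $\gamma>0$ with: (i) $\mathsf{d}(a+c,b+c)\leq\gamma\,\mathsf{d}(a,b)$ for all $a,b,c\in\mathfrak{A}$; (ii) $\mathsf{d}(\lambda a,\lambda b)\leq\gamma|\lambda|\,\mathsf{d}(a,b)$ for all $\lambda\in\mathbb{F}$, $a,b\in\mathfrak{A}$; (iii) $\mathsf{d}(ac,bc)\leq\gamma\,\mathsf{d}(c,0)\,\mathsf{d}(a,b)$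 and $\mathsf{d}(ca,cb)\leq\gamma\,\mathsf{d}(c,0)\,\mathsf{d}(a,b)$ for all $a,b,c\in\mathfrak{A}$. It is a complete metric $\mathbb{F}$-algebra if $(\mathfrak{A},\mathsf{d})$ is a complete metric space. *)

theory Defs
  imports "HOL-Analysis.Analysis" "HOL-Computational_Algebra.Computational_Algebra"
begin

text \<open>
  The norm of a field is only submultiplicative. It is a locale parameter because the library's
  normed fields are real algebras with a multiplicative norm.
\<close>

locale normed_field =
  fixes nrm :: "'f::field \<Rightarrow> real"
  assumes nrm_nonneg: "0 \<le> nrm x"
    and nrm_eq_0_iff: "nrm x = 0 \<longleftrightarrow> x = 0"
    and nrm_triangle: "nrm (x + y) \<le> nrm x + nrm y"
    and nrm_minus: "nrm (- x) = nrm x"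
    and nrm_mult: "nrm (x * y) \<le> nrm x * nrm y"
    and nrm_of_nat_mult: "CHAR('f) = 0 \<Longrightarrow> nrm (of_nat n * x) = real n * nrm x"

text \<open>
  The class \<open>ring\<close> is that of associative, not necessarily unital rings. The metric is \<open>dist\<close>;
  nothing but the locale assumptions relates it to the algebraic structure.
\<close>

locale metric_algebra = normed_field nrm + vector_space scale
  for nrm :: "'f::field \<Rightarrow> real"
    and scale :: "'f \<Rightarrow> 'a::{ring, metric_space} \<Rightarrow> 'a" +
  assumes scale_mult_left: "scale r a * b = scale r (a * b)"
    and scale_mult_right: "a * scale r b = scale r (a * b)"
    and metric_compatible: "\<exists>\<gamma>>0.
      (\<forall>a b c::'a. dist (a + c) (b + c) \<le> \<gamma> * dist a b) \<and>
      (\<forall>r. \<forall>a b::'a. dist (scale r a) (scale r b) \<le> \<gamma> * nrm r * dist a b) \<and>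
      (\<forall>a b c::'a. dist (a * c) (b * c) \<le> \<gamma> * dist c 0 * dist a b \<and>
                   dist (c * a) (c * b) \<le> \<gamma> * dist c 0 * dist a b)"

locale complete_metric_algebra = metric_algebra nrm scale
  for nrm :: "'f::field \<Rightarrow> real"
    and scale :: "'f \<Rightarrow> 'a::{ring, complete_space} \<Rightarrow> 'a"

text \<open>
  Ideals are ideals of the underlying ring: closure under the scalar action is not required.
\<close>

definition additive_subgroup :: "'a::ab_group_add set \<Rightarrow> bool" where
  "additive_subgroup I \<longleftrightarrow> 0 \<in> I \<and> (\<forall>a\<in>I. \<forall>b\<in>I. a + b \<in> I) \<and> (\<forall>a\<in>I. - a \<in> I)"

definition left_ideal :: "'a::ring set \<Rightarrow> bool" where
  "left_ideal I \<longleftrightarrow> additive_subgroup I \<and> (\<forall>r. \<forall>a\<in>I. r * a \<in> I)"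

definition right_ideal :: "'a::ring set \<Rightarrow> bool" where
  "right_ideal I \<longleftrightarrow> additive_subgroup I \<and> (\<forall>r. \<forall>a\<in>I. a * r \<in> I)"

definition two_sided_ideal :: "'a::ring set \<Rightarrow> bool" where
  "two_sided_ideal I \<longleftrightarrow> left_ideal I \<and> right_ideal I"

text \<open>
  The library's \<open>a ^ n\<close> needs a unit. Here \<open>pos_power a n\<close> is the \<open>n\<close>-th power of \<open>a\<close> for
  \<open>n > 0\<close> only; its value at \<open>n = 0\<close> has no meaning.
\<close>

definition pos_power :: "'a::ring \<Rightarrow> nat \<Rightarrow> 'a" where
  "pos_power a n = ((\<lambda>x. a * x) ^^ (n - 1)) a"

definition nil :: "'a::ring set \<Rightarrow> bool" where
  "nil I \<longleftrightarrow> (\<forall>a\<in>I. \<exists>n>0. pos_power a n = 0)"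

end

theory Submission
  imports Defs
begin

text \<open>
  Let \<open>x\<close> lie in a nil one-sided ideal. For every \<open>a\<close> some product \<open>x a x a \<dots> a x\<close> vanishes, so by
  Baire there is a fixed length \<open>n\<close> for which it vanishes for all \<open>a\<close> in a ball around some \<open>c\<close>.
  In characteristic zero the scalars \<open>1 / m\<close> tend to zero, hence the polynomial
  \<open>t \<mapsto> x (c + t b) x \<dots> (c + t b) x\<close> has infinitely many roots and its leading coefficient
  \<open>x b x \<dots> b x\<close> is zero for all \<open>b\<close>. In a semiprime ring this identity forces \<open>x = 0\<close>, by
  Levitzki's argument, carried out here by induction on \<open>n\<close> with the quotient rings
  replaced by the products \<open>r \<circ> s = r x s\<close>.
\<close>

section \<open>Levitzki's argument\<close>

text \<open>For \<open>n > 0\<close> this is \<open>u * p * u\<close>, where p is the n-th power of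
  \<open>r\<close> for the product r \<circ> s = r u s. It vanishes iff p is zero in the quotient of
  this \<circ>-ring by its ideal of all s with \<open>u * s * u = 0\<close>.\<close>

primrec alt_prod :: "'a::ring \<Rightarrow> nat \<Rightarrow> 'a \<Rightarrow> 'a" where
  "alt_prod u 0 r = u"
| "alt_prod u (Suc n) r = u * r * alt_prod u n r"

lemma alt_prod_eq_left: "alt_prod x (Suc n) a = x * pos_power (a * x) (Suc n)"
  by (induction n) (simp_all add: pos_power_def mult.assoc)

lemma alt_prod_eq_right: "alt_prod x (Suc n) a = pos_power (x * a) (Suc n) * x"
  by (induction n) (simp_all add: pos_power_def mult.assoc)

text \<open>The assumption says v \<circ> v = 0 in that quotient, so \<open>v\<close> kills v
  \<circ> s + v from the left.\<close>

lemma alt_prod_left_zero: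
  assumes "u * v * u * v * u = 0"
  shows "u * v * alt_prod u (Suc k) (v * u * s + v) = 0"
proof -
  \<comment> \<open>The summand \<open>v\<close> completes the zero word
    \<open>u * v * u * v * u\<close> only with the \<open>u\<close> that opens the last factor; that
    factor is \<open>u\<close> itself for \<open>k = 0\<close> and \<open>u * z\<close>
    otherwise.\<close>
  have "u * v * (u * (v * u * s + v)) * alt_prod u k (v * u * s + v) = 0"
  proof (cases k)
    case 0
    have "u * v * (u * (v * u * s + v)) * u = (u * v * u * v * u) * s * u + u * v * u * v * u"
      by (simp add: algebra_simps)
    then show ?thesis using 0 assms by simp
  next
    case (Suc j)
    have "u * v * (u * (v * u * s + v)) * (u * z) = (u * v * u * v * u) * s * u * z + (u * v * u * v * u) * z" for z
      by (simp add: algebra_simps)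
    then have "u * v * (u * (v * u * s + v)) * (u * z) = 0" for z
      using assms by simp
    then show ?thesis using Suc by (simp only: alt_prod.simps mult.assoc)
  qed
  then show ?thesis by (simp add: mult.assoc)
qed

text \<open>As v \<circ> v = 0, a power of v \<circ> s + v keeps two words only: a bare
  \<open>v\<close> can survive only as the last factor. The second word is an alternating product in
  \<open>u * v * u\<close> of smaller length, which makes induction on the length possible.\<close>

lemma alt_prod_add:
  assumes "u * v * u * v * u = 0"
  shows "alt_prod u (Suc k) (v * u * s + v) = alt_prod u (Suc k) (v * u * s) + alt_prod (u * v * u) k s"
proof (induction k)
  case 0
  show ?case by (simp add: algebra_simps)
next
  case (Suc k)
  let ?r = "v * u * s + v"
  have "alt_prod u (Suc (Suc k)) ?r = u * v * u * s * alt_prod u (Suc k) ?r + u * v * alt_prod u (Suc k) ?r"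
    by (subst alt_prod.simps(2)) (simp only: distrib_left distrib_right mult.assoc)
  also have "\<dots> = u * v * u * s * alt_prod u (Suc k) ?r"
    using alt_prod_left_zero[OF assms] by simp
  also have "\<dots> = u * (v * u * s) * alt_prod u (Suc k) (v * u * s) + u * v * u * s * alt_prod (u * v * u) k s"
    unfolding Suc.IH by (simp only: distrib_left mult.assoc)
  finally show ?case by simp
qed

text \<open>\<open>v\<close> is the \<circ>-power of \<open>r\<close> with exponent k + 1, so
  \<open>u * v\<close> ends in \<open>u * r\<close>. This is expressed through annihilation because,
  without a unit, a left cofactor need not exist for \<open>k = 0\<close>.\<close>

lemma alt_prod_Suc_sandwich:
  "\<exists>v. alt_prod u (Suc k) r = u * v * u \<and> (\<forall>y. u * r * y = 0 \<longrightarrow> u * v * y = 0)"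
proof (induction k)
  case 0
  show ?case by auto
next
  case (Suc k)
  then obtain v where v: "alt_prod u (Suc k) r = u * v * u" "\<forall>y. u * r * y = 0 \<longrightarrow> u * v * y = 0"
    by blast
  have "alt_prod u (Suc (Suc k)) r = u * (r * u * v) * u"
    by (subst alt_prod.simps(2), subst v(1)) (simp only: mult.assoc)
  moreover have "u * (r * u * v) * y = 0" if "u * r * y = 0" for y
  proof -
    have "u * (r * u * v) * y = u * r * (u * v * y)" by (simp only: mult.assoc)
    then show ?thesis using v(2) that by simp
  qed
  ultimately show ?case by blast
qed

text \<open>\<open>reduced\<close> says that the quotient has no nonzero elements of square zero,
  hence no nilpotent ones. The exponent falls one at a time: if the power k + 2 of \<open>r\<close>
  vanishes, the power k + 1 has square zero.\<close>

lemma alt_prod_descent: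
  assumes reduced: "\<And>v. u * v * u * v * u = 0 \<Longrightarrow> u * v * u = 0"
    and "alt_prod u (Suc k) r = 0"
  shows "u * r * u = 0"
  using assms(2)
proof (induction k)
  case 0
  then show ?case by simp
next
  case (Suc k)
  obtain v where v: "alt_prod u (Suc k) r = u * v * u" "\<forall>y. u * r * y = 0 \<longrightarrow> u * v * y = 0"
    using alt_prod_Suc_sandwich by blast
  have "u * r * (u * v * u) = 0"
    using Suc.prems v(1) by (metis alt_prod.simps(2))
  then have "u * v * (u * v * u) = 0" using v(2) by blast
  then have "u * v * u = 0" using reduced by (simp add: mult.assoc)
  then show ?case using Suc.IH v(1) by simp
qed

lemma semiprime_alt_prod_zero:
  fixes u :: "'a::ring"
  assumes semiprime: "\<And>u :: 'a. (\<And>r. u * r * u = 0) \<Longrightarrow> u = 0"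
    and "\<And>r. alt_prod u n r = 0"
  shows "u = 0"
  using assms(2)
proof (induction n arbitrary: u)
  case 0
  then show ?case by simp
next
  case (Suc n)
  \<comment> \<open>Both alternating products in \<open>u\<close> in \<open>alt_prod_add\<close>
    vanish, so \<open>u * v * u\<close> satisfies the identity of length \<open>n\<close> and the
    induction hypothesis applies to it.\<close>
  have "u * v * u = 0" if "u * v * u * v * u = 0" for v
    using Suc.IH alt_prod_add[OF that] Suc.prems by (metis add_0)
  then show ?case
    using alt_prod_descent Suc.prems semiprime by blast
qed

section \<open>Rings without nil ideals\<close>

text \<open>This is the ideal A u A of the ring A. Without a unit it need not contain
  \<open>u\<close>.\<close>

inductive_set sandwich_ideal :: "'a::ring \<Rightarrow> 'a set" for u where
  zero: "0 \<in> sandwich_ideal u"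
| step: "z \<in> sandwich_ideal u \<Longrightarrow> a * u * b + z \<in> sandwich_ideal u"

lemma sandwich_ideal_add:
  "y \<in> sandwich_ideal u \<Longrightarrow> z \<in> sandwich_ideal u \<Longrightarrow> y + z \<in> sandwich_ideal u"
  by (induction rule: sandwich_ideal.induct) (simp_all add: add.assoc sandwich_ideal.step)

lemma two_sided_ideal_sandwich_ideal: "two_sided_ideal (sandwich_ideal u)"
proof -
  have "- z \<in> sandwich_ideal u" if "z \<in> sandwich_ideal u" for z
    using that
  proof induction
    case (step z a b)
    then show ?case using sandwich_ideal.step[of "- z" u "- a" b] by simp
  qed (simp add: sandwich_ideal.zero)
  moreover have "r * z \<in> sandwich_ideal u" if "z \<in> sandwich_ideal u" for r z
    using that
  proof induction
    case (step z a b)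
    then show ?case using sandwich_ideal.step[of "r * z" u "r * a" b]
      by (simp add: distrib_left mult.assoc)
  qed (simp add: sandwich_ideal.zero)
  moreover have "z * r \<in> sandwich_ideal u" if "z \<in> sandwich_ideal u" for r z
    using that
  proof induction
    case (step z a b)
    then show ?case using sandwich_ideal.step[of "z * r" u a "b * r"]
      by (simp add: distrib_right mult.assoc)
  qed (simp add: sandwich_ideal.zero)
  ultimately show ?thesis
    by (simp add: two_sided_ideal_def left_ideal_def right_ideal_def additive_subgroup_def
        sandwich_ideal.zero sandwich_ideal_add)
qed

lemma nil_if_square_zero:
  assumes "\<And>z. z \<in> I \<Longrightarrow> z * z = 0"
  shows "nil I"
  unfolding nil_def
proof
  fix z assume "z \<in> I"
  then have "pos_power z 2 = 0" using assms by (simp add: pos_power_def)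
  then show "\<exists>n>0. pos_power z n = 0" by (intro exI[of _ 2]) simp
qed

lemma sandwich_ideal_mult_zero:
  assumes "\<And>r. u * r * u = 0" and "y \<in> sandwich_ideal u" and "z \<in> sandwich_ideal u"
  shows "y * z = 0"
proof -
  have *: "(a * u * b) * z = 0" for a b
    using assms(3)
  proof induction
    case (step z c d)
    have "(a * u * b) * (c * u * d) = a * (u * (b * c) * u) * d" by (simp only: mult.assoc)
    then show ?case using step assms(1) by (simp add: distrib_left)
  qed simp
  show ?thesis
    using assms(2) by induction (use * in \<open>simp_all add: distrib_right\<close>)
qed

lemma semiprime_if_no_nil_ideals:
  fixes u :: "'a::ring"
  assumes no_nil: "\<And>I :: 'a set. two_sided_ideal I \<Longrightarrow> nil I \<Longrightarrow> I = {0}"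
    and u: "\<And>r. u * r * u = 0"
  shows "u = 0"
proof -
  have "sandwich_ideal u = {0}"
    by (intro no_nil two_sided_ideal_sandwich_ideal nil_if_square_zero)
      (rule sandwich_ideal_mult_zero[OF u])
  then have *: "a * u * b = 0" for a b
    using sandwich_ideal.step[OF sandwich_ideal.zero, of a u b] by simp
  \<comment> \<open>Passing from \<open>a * u * b = 0\<close> to \<open>u = 0\<close> without a unit
    takes two cancellations. Both annihilators of the ring are two-sided ideals of square zero,
    hence trivial.\<close>
  have right: "z = 0" if "\<And>a. z * a = 0" for z :: 'a
  proof -
    have "{z :: 'a. \<forall>a. z * a = 0} = {0}"
      by (intro no_nil nil_if_square_zero)
        (auto simp: two_sided_ideal_def left_ideal_def right_ideal_def additive_subgroup_def
          distrib_right mult.assoc)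
    then show ?thesis using that by blast
  qed
  have left: "z = 0" if "\<And>a. a * z = 0" for z :: 'a
  proof -
    have "{z :: 'a. \<forall>a. a * z = 0} = {0}"
      by (intro no_nil nil_if_square_zero)
        (auto simp: two_sided_ideal_def left_ideal_def right_ideal_def additive_subgroup_def
          distrib_left mult.assoc[symmetric])
    then show ?thesis using that by blast
  qed
  show ?thesis using * left right by blast
qed

section \<open>Polynomials with coefficients in an algebra\<close>

lemma (in vector_space) exists_linear_functional:
  assumes "v \<noteq> 0"
  obtains f where "Vector_Spaces.linear scale (*) f" and "f v \<noteq> 0"
proof -
  interpret pair: vector_space_pair scale "(*) :: 'a \<Rightarrow> 'a \<Rightarrow> 'a"
    by unfold_locales (simp_all add: algebra_simps)
  have "independent {v}" using assms by simp
  from pair.linear_independent_extend[OF this, of "\<lambda>_. 1"] show ?thesis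
    using that by auto
qed

text \<open>A linear functional that is nonzero on \<open>c k\<close> turns the sum into a nonzero
  scalar polynomial, which has finitely many roots.\<close>

lemma (in vector_space) vector_poly_coeff_zero:
  assumes inf: "infinite {t. (\<Sum>k\<le>n. scale (t ^ k) (c k)) = 0}"
    and "k \<le> n"
  shows "c k = 0"
proof (rule ccontr)
  assume "c k \<noteq> 0"
  then obtain f where f: "Vector_Spaces.linear scale (*) f" and "f (c k) \<noteq> 0"
    using exists_linear_functional by blast
  interpret f: Vector_Spaces.linear scale "(*)" f by (rule f)
  define p where "p = (\<Sum>i\<le>n. monom (f (c i)) i)"
  have "coeff p k = f (c k)"
    unfolding p_def using \<open>k \<le> n\<close> by (rule coeff_sum_monom)
  then have "p \<noteq> 0" using \<open>f (c k) \<noteq> 0\<close> by auto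
  then have "finite {t. poly p t = 0}" by (rule poly_roots_finite)
  moreover have "poly p t = f (\<Sum>k\<le>n. scale (t ^ k) (c k))" for t
    by (simp add: p_def poly_sum poly_monom f.sum f.scale mult.commute)
  then have "{t. (\<Sum>k\<le>n. scale (t ^ k) (c k)) = 0} \<subseteq> {t. poly p t = 0}"
    using f.zero by auto
  ultimately show False using inf finite_subset by blast
qed

context metric_algebra
begin

lemma alt_prod_expansion:
  "\<exists>c. c n = alt_prod x n b \<and> (\<forall>t. alt_prod x n (a + scale t b) = (\<Sum>k\<le>n. scale (t ^ k) (c k)))"
proof (induction n)
  case 0
  show ?case by auto
next
  case (Suc n)
  then obtain c where c: "c n = alt_prod x n b"
    "\<And>t. alt_prod x n (a + scale t b) = (\<Sum>k\<le>n. scale (t ^ k) (c k))"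
    by blast
  \<comment> \<open>The coefficients of the product with x a + t x b. The guards are needed because
    \<open>c\<close> is unspecified above \<open>n\<close> and \<open>k - 1\<close> truncates at
    zero.\<close>
  define d where "d k = (if k \<le> n then x * a * c k else 0) + (if k = 0 then 0 else x * b * c (k - 1))" for k
  have "alt_prod x (Suc n) (a + scale t b) = (\<Sum>k\<le>Suc n. scale (t ^ k) (d k))" for t
  proof -
    have "alt_prod x (Suc n) (a + scale t b) = (x * a + scale t (x * b)) * (\<Sum>k\<le>n. scale (t ^ k) (c k))"
      by (simp add: c(2) distrib_left scale_mult_right)
    also have "\<dots> = (\<Sum>k\<le>n. scale (t ^ k) (x * a * c k)) + (\<Sum>k\<le>n. scale (t ^ Suc k) (x * b * c k))"
      by (simp add: distrib_right sum_distrib_left scale_mult_right scale_mult_left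
          scale_sum_right scale_right_distrib sum.distrib mult.assoc mult.commute[of t])
    also have "(\<Sum>k\<le>n. scale (t ^ k) (x * a * c k))
        = (\<Sum>k\<le>Suc n. scale (t ^ k) (if k \<le> n then x * a * c k else 0))"
      by simp
    also have "(\<Sum>k\<le>n. scale (t ^ Suc k) (x * b * c k))
        = (\<Sum>k\<le>Suc n. scale (t ^ k) (if k = 0 then 0 else x * b * c (k - 1)))"
      by (subst sum.atMost_Suc_shift) simp
    also have "(\<Sum>k\<le>Suc n. scale (t ^ k) (if k \<le> n then x * a * c k else 0)) + \<dots>
        = (\<Sum>k\<le>Suc n. scale (t ^ k) (d k))"
      by (simp only: d_def scale_right_distrib sum.distrib)
    finally show ?thesis .
  qed
  moreover have "d (Suc n) = alt_prod x (Suc n) b"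
    by (simp add: d_def c(1))
  ultimately show ?case by blast
qed

section \<open>Baire category\<close>

lemma continuous_on_times:
  fixes f g :: "'c::topological_space \<Rightarrow> 'a"
  assumes "continuous_on S f" and "continuous_on S g"
  shows "continuous_on S (\<lambda>z. f z * g z)"
  unfolding continuous_on_def
proof
  fix z assume "z \<in> S"
  obtain \<gamma> where \<gamma>: "dist (a * c) (b * c) \<le> \<gamma> * dist c 0 * dist a b"
    "dist (c * a) (c * b) \<le> \<gamma> * dist c 0 * dist a b" for a b c :: 'a
    using metric_compatible by blast
  have f: "(f \<longlongrightarrow> f z) (at z within S)" and g: "(g \<longlongrightarrow> g z) (at z within S)"
    using assms \<open>z \<in> S\<close> by (auto simp: continuous_on_def)
  have "((\<lambda>w. \<gamma> * dist (g w) 0 * dist (f w) (f z) + \<gamma> * dist (f z) 0 * dist (g w) (g z))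
      \<longlongrightarrow> \<gamma> * dist (g z) 0 * dist (f z) (f z) + \<gamma> * dist (f z) 0 * dist (g z) (g z)) (at z within S)"
    by (intro tendsto_intros f g)
  then have lim: "((\<lambda>w. \<gamma> * dist (g w) 0 * dist (f w) (f z) + \<gamma> * dist (f z) 0 * dist (g w) (g z))
      \<longlongrightarrow> 0) (at z within S)"
    by simp
  \<comment> \<open>The detour goes through \<open>f z * g w\<close>; \<open>dist (g w) 0\<close>
    converges, so the bound tends to zero.\<close>
  have "dist (f w * g w) (f z * g z)
      \<le> \<gamma> * dist (g w) 0 * dist (f w) (f z) + \<gamma> * dist (f z) 0 * dist (g w) (g z)" for w
    using dist_triangle[of "f w * g w" "f z * g z" "f z * g w"] \<gamma>(1)[of "f w" "g w" "f z"]
      \<gamma>(2)[of "f z" "g w" "g z"] by linarith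
  then have "((\<lambda>w. dist (f w * g w) (f z * g z)) \<longlongrightarrow> 0) (at z within S)"
    by (intro tendsto_sandwich[OF _ _ tendsto_const lim]) auto
  then show "((\<lambda>w. f w * g w) \<longlongrightarrow> f z * g z) (at z within S)"
    using tendsto_dist_iff by blast
qed

lemma continuous_on_alt_prod: "continuous_on S (\<lambda>a :: 'a. alt_prod x n a)"
  by (induction n) (auto intro!: continuous_on_times continuous_intros)

lemma closed_alt_prod_zeros: "closed {a :: 'a. alt_prod x n a = 0}"
  by (intro closed_Collect_eq continuous_on_alt_prod continuous_on_const)

lemma tendsto_scale_inverse_of_nat:
  assumes "CHAR('f) = 0"
  shows "(\<lambda>m. a + scale (inverse (of_nat m)) b) \<longlonglongrightarrow> a"
proof -
  obtain \<gamma> where "\<gamma> > 0" and \<gamma>: "\<And>a b c :: 'a. dist (a + c) (b + c) \<le> \<gamma> * dist a b"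
    "\<And>r. \<And>a b :: 'a. dist (scale r a) (scale r b) \<le> \<gamma> * nrm r * dist a b"
    using metric_compatible by blast
  \<comment> \<open>With a submultiplicative norm \<open>nrm 1\<close> may differ from 1, so it
    stays as a constant.\<close>
  have nrm_inverse: "nrm (inverse (of_nat m)) = nrm 1 * inverse (real m)" if "m > 0" for m
  proof -
    have "(of_nat m :: 'f) \<noteq> 0" using that assms by (simp add: of_nat_eq_0_iff_char_dvd)
    then show ?thesis
      using nrm_of_nat_mult[OF assms, of m "inverse (of_nat m)"] that by (simp add: field_simps)
  qed
  have "dist (a + scale (inverse (of_nat m)) b) a
      \<le> \<gamma> * (\<gamma> * (nrm 1 * inverse (real m)) * dist b 0)" if "m > 0" for m
  proof -
    \<comment> \<open>The metric need not be translation invariant, so removing \<open>a\<close>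
      costs one factor \<gamma> and scaling costs another.\<close>
    have "dist (scale (inverse (of_nat m)) b + a) (0 + a)
        \<le> \<gamma> * dist (scale (inverse (of_nat m)) b) (scale (inverse (of_nat m)) 0)"
      using \<gamma>(1)[where a = "scale (inverse (of_nat m)) b" and b = 0 and c = a] by simp
    also have "\<dots> \<le> \<gamma> * (\<gamma> * nrm (inverse (of_nat m)) * dist b 0)"
      using \<gamma>(2)[of "inverse (of_nat m)" b 0] \<open>\<gamma> > 0\<close> by (intro mult_left_mono) auto
    finally show ?thesis using nrm_inverse[OF that] by (simp add: add.commute)
  qed
  then have bound: "\<forall>\<^sub>F m in sequentially. dist (a + scale (inverse (of_nat m)) b) a
      \<le> \<gamma> * (\<gamma> * (nrm 1 * inverse (real m)) * dist b 0)"
    using eventually_gt_at_top[of 0] by (rule eventually_mono[rotated])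
  have "(\<lambda>m. \<gamma> * (\<gamma> * (nrm 1 * inverse (real m)) * dist b 0)) \<longlonglongrightarrow> \<gamma> * (\<gamma> * (nrm 1 * 0) * dist b 0)"
    by (intro tendsto_intros lim_inverse_n)
  then have lim: "(\<lambda>m. \<gamma> * (\<gamma> * (nrm 1 * inverse (real m)) * dist b 0)) \<longlonglongrightarrow> 0"
    by simp
  have "(\<lambda>m. dist (a + scale (inverse (of_nat m)) b) a) \<longlonglongrightarrow> 0"
    by (rule tendsto_sandwich[OF _ bound tendsto_const lim]) simp
  then show ?thesis using tendsto_dist_iff by blast
qed

lemma alt_prod_zero_if_interior:
  assumes char: "CHAR('f) = 0" and a: "a \<in> interior {a :: 'a. alt_prod x n a = 0}"
  shows "alt_prod x n b = 0"
proof -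
  obtain c where c: "c n = alt_prod x n b"
    "\<And>t. alt_prod x n (a + scale t b) = (\<Sum>k\<le>n. scale (t ^ k) (c k))"
    using alt_prod_expansion by blast
  let ?Z = "{t. (\<Sum>k\<le>n. scale (t ^ k) (c k)) = 0}"
  have "\<forall>\<^sub>F m in sequentially. a + scale (inverse (of_nat m)) b \<in> interior {a. alt_prod x n a = 0}"
    using topological_tendstoD[OF tendsto_scale_inverse_of_nat[OF char] open_interior a] .
  then obtain N where "\<And>m. m \<ge> N \<Longrightarrow> a + scale (inverse (of_nat m)) b \<in> interior {a. alt_prod x n a = 0}"
    unfolding eventually_sequentially by blast
  then have "inverse (of_nat m) \<in> ?Z" if "m \<ge> N" for m
    using that c(2) interior_subset by fastforce
  then have "(\<lambda>m. inverse (of_nat m)) ` {N..} \<subseteq> ?Z" by blast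
  moreover have "inj (of_nat :: nat \<Rightarrow> 'f)"
  proof (rule linorder_injI)
    fix i j :: nat assume "i < j"
    then have "(of_nat (j - i) :: 'f) \<noteq> 0"
      using char by (simp add: of_nat_eq_0_iff_char_dvd del: of_nat_diff)
    then show "(of_nat i :: 'f) \<noteq> of_nat j"
      using \<open>i < j\<close> by (simp add: of_nat_diff)
  qed
  \<comment> \<open>If \<open>N = 0\<close>, the value at \<open>m = 0\<close> is
    \<open>inverse 0 = 0\<close>, which is still distinct from the others.\<close>
  then have "inj_on (\<lambda>m. inverse (of_nat m :: 'f)) {N..}"
    by (auto simp: inj_on_def)
  then have "infinite ((\<lambda>m. inverse (of_nat m :: 'f)) ` {N..})"
    by (simp add: finite_image_iff infinite_Ici)
  ultimately have "infinite ?Z" using infinite_super by blast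
  then show ?thesis using vector_poly_coeff_zero c(1) by fastforce
qed

end

lemma (in complete_metric_algebra) alt_prod_bounded_index:
  assumes char: "CHAR('f) = 0" and "\<And>a :: 'a. \<exists>n. alt_prod x n a = 0"
  shows "\<exists>n. \<forall>a. alt_prod x n a = 0"
proof -
  have "\<exists>n. interior {a. alt_prod x n a = 0} \<noteq> {}"
  proof (rule ccontr)
    assume "\<not> ?thesis"
    \<comment> \<open>Closed sets without interior points would have a union without interior
      points, but these sets cover the space.\<close>
    then have "euclidean interior_of \<Union>(range (\<lambda>n. {a. alt_prod x n a = 0})) = {}"
      using closed_alt_prod_zeros
      by (intro Baire_category_alt) (auto simp: completely_metrizable_space_euclidean)
    moreover have "\<Union>(range (\<lambda>n. {a. alt_prod x n a = 0})) = UNIV"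
      using assms(2) by blast
    ultimately show False by simp
  qed
  then show ?thesis using alt_prod_zero_if_interior[OF char] by blast
qed

theorem corollary2p8:
  fixes nrm :: "'f::field \<Rightarrow> real"
    and scale :: "'f \<Rightarrow> 'a::{ring, complete_space} \<Rightarrow> 'a"
  assumes "CHAR('f) = 0"
    and "complete_metric_algebra nrm scale"
    and "\<And>I :: 'a set. two_sided_ideal I \<Longrightarrow> nil I \<Longrightarrow> I = {0}"
  shows "\<forall>I :: 'a set. (left_ideal I \<or> right_ideal I) \<and> nil I \<longrightarrow> I = {0}"
proof (intro allI impI)
  fix I :: "'a set"
  assume I: "(left_ideal I \<or> right_ideal I) \<and> nil I"
  interpret complete_metric_algebra nrm scale by (rule assms(2))
  have "x = 0" if "x \<in> I" for x
  proof -
    \<comment> \<open>x (a x)^n and (x a)^n x are the same word, so left and right ideals lead to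
      the same identity.\<close>
    have "\<exists>n. alt_prod x n a = 0" for a
    proof (cases "left_ideal I")
      case True
      then have "a * x \<in> I" using that by (simp add: left_ideal_def)
      then obtain n where "n > 0" "pos_power (a * x) n = 0" using I by (auto simp: nil_def)
      then show ?thesis using alt_prod_eq_left[of x "n - 1" a] by (intro exI[of _ n]) simp
    next
      case False
      then have "x * a \<in> I" using that I by (simp add: right_ideal_def)
      then obtain n where "n > 0" "pos_power (x * a) n = 0" using I by (auto simp: nil_def)
      then show ?thesis using alt_prod_eq_right[of x "n - 1" a] by (intro exI[of _ n]) simp
    qed
    then obtain n where "\<forall>a. alt_prod x n a = 0"
      using alt_prod_bounded_index[OF assms(1)] by blast
    then show ?thesis
      using semiprime_alt_prod_zero semiprime_if_no_nil_ideals[OF assms(3)] by blast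
  qed
  moreover have "0 \<in> I"
    using I by (auto simp: left_ideal_def right_ideal_def additive_subgroup_def)
  ultimately show "I = {0}" by blast
qed

end
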